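(* Let $H\subset E$ be Hilbert spaces and $(\nu_t)_{t>0}$ the probability measures on $E$ described in the context, satisfying (HS) and (H). Let $x\in E\setminus H$, let $q_x$ and $E_x=\{z\in E:q_x(z)<\infty\}$ be as in the context, and let $t>0$. Then: (i) $q_x\in L^2(E,\nu_t)$; in particular $\nu_t(E_x)=1$ and $\nu_t(H+x)=0$. (ii) $H\subset E_x$ continuously. (iii) For all $z\in E$ we have $\|z\|\le q_x(z)$. In particular, $(E_x,q_x)$ is complete. Furthermore, $(E_x,q_x)$ is compactly embedded into $(E,\|\cdot\|)$.
   Context: $(H,\langle\cdot,\cdot\rangle)$ is a separable real Hilbert space with norm $|\cdot|$; $(E,\langle\cdot,\cdot\rangle_E)$ is a Hilbert space with norm $\|\cdot\|$ such that $H\subset E$ continuously and densely; identifying $H$ with $H'$, $E'\subset H\subset E$ continuously and densely; ${}_{E'}\langle\xi,z\rangle_E=\xi(z)$, which equals $\langle\xi,z\rangle$ for $z\in H$. (HS): the embedding $H\subset E$ is Hilbert–Schmidt. $\psi:H\to\mathbb C$ is a continuous negative definite function (so that $e^{-t\psi}$ is positive definite for each $t>0$) with $\psi(0)=0$. For $t>0$, $\nu_t$ is the probability measure on $(E,\mathcal B(E))$ with $\int_E e^{i\,{}_{E'}\langle\xi,z\rangle_E}\nu_t(dz)=e^{-t\psi(\xi)}$, $\xi\in E'$ (it exists by the Bochner–Minlos theorem). (H): (i) there is $C>0$ such that $\int_E {}_{E'}\langle\xi,z\rangle_E^2\,\nu_t(dz)\le C(1+t^2)|\xi|^2$ for all $\xi\in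 E'$, $t>0$; (ii) $\nu_t(H)=0$ for all $t>0$. Fix an orthonormal basis $\{e_n:n\ge1\}$ of $H$ contained in $E'$ and $\lambda_n\in(0,\infty)$ with $\sum_n\lambda_n<\infty$ such that $\overline e_n:=e_n/\sqrt{\lambda_n}$, $n\ge1$, form an orthonormal basis of $E$ and $\lambda_n\,{}_{E'}\langle e_n,z\rangle_E=\langle e_n,z\rangle_E$ for all $n$ and $z\in E$ (such a basis exists by (HS)). Let $\alpha_n\in(0,\infty)$, $n\ge1$, with $\alpha_n\nearrow\infty$ as $n\to\infty$ and $\sum_n\alpha_n\lambda_n<\infty$. For $x\in E\setminus H$, fix an orthonormal basis $\{e_n^x:n\ge1\}$ of $H$ with $e_n^x\in E'$, separating the points of $E$, with ${}_{E'}\langle e_n^x,x\rangle_E\ge2^{n/2}$ for all $n$ (such a basis exists), and define $$q_x(z):=\Big[\sum_{n=1}^\infty\alpha_n\lambda_n\,{}_{E'}\langle e_n,z\rangle_E^2+\Big(\sum_{n=1}^\infty2^{-n/2}|{}_{E'}\langle e_n^x,z\rangle_E|\Big)^2\Big]^{1/2},\quad z\in E,$$ $E_x:=\{z\in E:q_x(z)<\infty\}$, a linear subspace normed by $q_x$.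
   Formalization: The bound ‖z‖ ≤ q_x(z) is proved only when α_1 ≥ 1, since it fails in general (λ_1=100, α_1=1/10, z=e_1: 100 > 11); for arbitrary α_n the bound √α_1‖z‖ ≤ q_x(z) is proved instead, and every other assertion is unconditional. *)

theory Defs
  imports "HOL-Probability.Probability"
begin

text \<open>
  The inclusion of \<open>H\<close> in \<open>E\<close> is an injective bounded linear map \<open>j\<close> from the type of \<open>H\<close> to
  the type of \<open>E\<close>. All sequences indexed by \<open>n \<ge> 1\<close> in the mathematics are indexed by \<open>nat\<close>
  here, so that the formal index \<open>n\<close> stands for \<open>n + 1\<close>.
\<close>

definition orthonormal_basis :: "'a::real_inner set \<Rightarrow> bool" where
  "orthonormal_basis B \<longleftrightarrow>
     (\<forall>b\<in>B. norm b = 1) \<and> pairwise orthogonal B \<and> closure (span B) = UNIV"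

definition orthonormal_basis_seq :: "(nat \<Rightarrow> 'a::real_inner) \<Rightarrow> bool" where
  "orthonormal_basis_seq b \<longleftrightarrow> inj b \<and> orthonormal_basis (range b)"

definition hilbert_schmidt :: "('h::real_inner \<Rightarrow> 'e::real_inner) \<Rightarrow> bool" where
  "hilbert_schmidt T \<longleftrightarrow>
     bounded_linear T \<and> (\<exists>B. orthonormal_basis B \<and> (\<lambda>b. (norm (T b))\<^sup>2) summable_on B)"

definition continuous_dense_embedding ::
    "('h::real_normed_vector \<Rightarrow> 'e::real_normed_vector) \<Rightarrow> bool" where
  "continuous_dense_embedding j \<longleftrightarrow> bounded_linear j \<and> inj j \<and> closure (range j) = UNIV"

text \<open>
  Under the Riesz identification of \<open>H\<close> with its dual, the dual of \<open>E\<close> is the set of those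
  \<open>\<xi>\<close> in \<open>H\<close> for which \<open>h \<mapsto> \<langle>\<xi>, h\<rangle>\<close> is the restriction to \<open>H\<close> of a continuous linear
  functional on \<open>E\<close>. That functional is unique because \<open>H\<close> is dense in \<open>E\<close>; its value at
  \<open>z\<close> is the dual pairing of \<open>\<xi>\<close> and \<open>z\<close>.
\<close>

definition dual_in :: "('h::real_inner \<Rightarrow> 'e::real_normed_vector) \<Rightarrow> 'h set" where
  "dual_in j = {\<xi>. \<exists>f::'e \<Rightarrow> real. bounded_linear f \<and> (\<forall>h. f (j h) = \<xi> \<bullet> h)}"

definition dual_pairing ::
    "('h::real_inner \<Rightarrow> 'e::real_normed_vector) \<Rightarrow> 'h \<Rightarrow> 'e \<Rightarrow> real" where
  "dual_pairing j \<xi> = (THE f. bounded_linear f \<and> (\<forall>h. f (j h) = \<xi> \<bullet> h))"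

lemma dual_pairing_unique:
  assumes j: "continuous_dense_embedding j"
    and f: "bounded_linear f" "\<forall>h. f (j h) = \<xi> \<bullet> h"
  shows "dual_pairing j \<xi> = f"
  unfolding dual_pairing_def
proof (rule the_equality)
  show "bounded_linear f \<and> (\<forall>h. f (j h) = \<xi> \<bullet> h)"
    using f by blast
next
  fix g assume g: "bounded_linear g \<and> (\<forall>h. g (j h) = \<xi> \<bullet> h)"
  have "g z - f z = 0" for z
  proof (rule continuous_constant_on_closure[where S = "range j" and f = "\<lambda>z. g z - f z"])
    show "continuous_on (closure (range j)) (\<lambda>z. g z - f z)"
      using g f(1) by (intro continuous_on_diff linear_continuous_on) auto
    show "g x - f x = 0" if "x \<in> range j" for x
      using that g f(2) by auto
    show "z \<in> closure (range j)"
      using j by (simp add: continuous_dense_embedding_def)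
  qed
  then show "g = f" by (auto simp: fun_eq_iff)
qed

lemma dual_pairing:
  assumes "continuous_dense_embedding j" "\<xi> \<in> dual_in j"
  shows "bounded_linear (dual_pairing j \<xi>)" "dual_pairing j \<xi> (j h) = \<xi> \<bullet> h"
  using assms dual_pairing_unique unfolding dual_in_def by fastforce+

text \<open>
  By Schoenberg's theorem, for \<open>\<psi> 0 = 0\<close> the following condition means precisely that
  \<open>exp (- t \<psi>)\<close> is positive definite for every \<open>t > 0\<close>.
\<close>

definition negative_definite :: "('h::ab_group_add \<Rightarrow> complex) \<Rightarrow> bool" where
  "negative_definite \<psi> \<longleftrightarrow>
     (\<forall>(n::nat) (\<xi>::nat \<Rightarrow> 'h) (c::nat \<Rightarrow> complex).
        (\<Sum>k<n. \<Sum>l<n. (\<psi> (\<xi> k) + cnj (\<psi> (\<xi> l)) - \<psi> (\<xi> k - \<xi> l)) * c k * cnj (c l))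
          \<in> \<real>\<^sub>\<ge>\<^sub>0)"

definition sqrt_ennreal :: "ennreal \<Rightarrow> ennreal" where
  "sqrt_ennreal a = (if a = \<infinity> then \<infinity> else ennreal (sqrt (enn2real a)))"

text \<open>
  The function \<open>q\<^sub>x\<close>; the argument \<open>ex\<close> is the basis chosen for \<open>x\<close>. The weight
  \<open>2 powr (- (real n + 1) / 2)\<close> is the mathematical \<open>2\<close> to the power \<open>- n / 2\<close> after the index shift.
\<close>

definition q_fun ::
    "('h::real_inner \<Rightarrow> 'e::real_normed_vector) \<Rightarrow> (nat \<Rightarrow> 'h) \<Rightarrow> (nat \<Rightarrow> real) \<Rightarrow> (nat \<Rightarrow> real)
      \<Rightarrow> (nat \<Rightarrow> 'h) \<Rightarrow> 'e \<Rightarrow> ennreal" where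
  "q_fun j e lam \<alpha> ex z =
     sqrt_ennreal
       ((\<Sum>n. ennreal (\<alpha> n * lam n * (dual_pairing j (e n) z)\<^sup>2))
        + (\<Sum>n. ennreal (2 powr (- (real n + 1) / 2) * \<bar>dual_pairing j (ex n) z\<bar>))\<^sup>2)"

definition fin_dom :: "('e \<Rightarrow> ennreal) \<Rightarrow> 'e set" where
  "fin_dom q = {z. q z < \<infinity>}"

definition norm_on_subspace :: "'e::real_vector set \<Rightarrow> ('e \<Rightarrow> ennreal) \<Rightarrow> bool" where
  "norm_on_subspace V q \<longleftrightarrow> subspace V \<and>
     (\<forall>u\<in>V. q u < \<infinity> \<and> (q u = 0 \<longleftrightarrow> u = 0)) \<and>
     (\<forall>u\<in>V. \<forall>a. q (a *\<^sub>R u) = ennreal \<bar>a\<bar> * q u) \<and>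
     (\<forall>u\<in>V. \<forall>v\<in>V. q (u + v) \<le> q u + q v)"

definition norm_dist :: "('e::ab_group_add \<Rightarrow> ennreal) \<Rightarrow> 'e \<Rightarrow> 'e \<Rightarrow> real" where
  "norm_dist q u v = enn2real (q (u - v))"

end

theory Submission
  imports Defs
begin

text \<open>
  The function \<open>q\<^sub>x\<close> is the supremum of the continuous seminorms obtained by truncating both
  series. This makes it a measurable extended norm with closed balls, which gives completeness.
  The vectors \<open>e\<^sub>n / \<surd>\<lambda>\<^sub>n\<close> form an orthonormal basis of \<open>E\<close> in which the first series is
  \<open>\<Sum>\<alpha>\<^sub>n \<langle>b\<^sub>n, z\<rangle>\<^sup>2\<close>; as \<open>\<alpha>\<^sub>n\<close> increases to infinity, a bound on \<open>q\<^sub>x\<close> controls the tails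
  of the expansion uniformly, so \<open>q\<^sub>x\<close>-bounded sets are relatively compact in \<open>E\<close>.
  Square integrability follows from the second moment bound, with Cauchy-Schwarz for the weights
  \<open>2\<^sup>-\<^sup>n\<^sup>/\<^sup>2\<close> in the second series. The estimate \<open>\<bar>\<langle>\<xi>, h\<rangle>\<bar> \<le> \<bar>h\<bar>\<close> for unit vectors
  \<open>\<xi>\<close> gives \<open>H \<subseteq> E\<^sub>x\<close>.
  The second series diverges at \<open>x\<close>, so \<open>H + x\<close> misses the subspace \<open>E\<^sub>x\<close> of full measure.
\<close>

section \<open>Square roots of extended nonnegative reals\<close>

text \<open>With \<open>le_sqrt_ennreal_iff\<close> this makes \<open>sqrt_ennreal\<close> both a
  left and a right adjoint of squaring, so monotonicity and compatibility with suprema follow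
  without case splits at infinity.\<close>

lemma sqrt_ennreal_le_iff: "sqrt_ennreal a \<le> c \<longleftrightarrow> a \<le> c\<^sup>2"
proof (cases a; cases c)
  fix r s assume "a = ennreal r" "c = ennreal s" "0 \<le> r" "0 \<le> s"
  then show ?thesis
    by (simp add: sqrt_ennreal_def ennreal_power flip: real_sqrt_le_iff[of r "s\<^sup>2"])
qed (auto simp: sqrt_ennreal_def top_unique ennreal_power power_eq_top_ennreal)

lemma le_sqrt_ennreal_iff: "b \<le> sqrt_ennreal c \<longleftrightarrow> b\<^sup>2 \<le> c"
proof (cases b; cases c)
  fix r s assume "b = ennreal r" "c = ennreal s" "0 \<le> r" "0 \<le> s"
  then show ?thesis
    by (simp add: sqrt_ennreal_def ennreal_power flip: real_sqrt_le_iff[of "r\<^sup>2" s])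
qed (auto simp: sqrt_ennreal_def top_unique ennreal_power power_eq_top_ennreal)

lemma sqrt_ennreal_power2: "(sqrt_ennreal a)\<^sup>2 = a"
  by (cases a) (auto simp: sqrt_ennreal_def ennreal_power power_eq_top_ennreal)

lemma sqrt_ennreal_ennreal: "0 \<le> r \<Longrightarrow> sqrt_ennreal (ennreal r) = ennreal (sqrt r)"
  by (simp add: sqrt_ennreal_def)

lemma power2_le_imp_le_ennreal: "b\<^sup>2 \<le> c\<^sup>2 \<Longrightarrow> b \<le> (c :: ennreal)"
  using le_sqrt_ennreal_iff[of b "c\<^sup>2"] sqrt_ennreal_le_iff[of "c\<^sup>2" c] by auto

lemma power2_SUP_ennreal: "(SUP i\<in>I. f i :: ennreal)\<^sup>2 = (SUP i\<in>I. (f i)\<^sup>2)"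
  by (intro antisym)
    (simp_all add: le_sqrt_ennreal_iff[symmetric] SUP_le_iff,
     auto simp: le_sqrt_ennreal_iff sqrt_ennreal_power2 intro: SUP_upper power_mono)

lemma sqrt_ennreal_SUP: "sqrt_ennreal (SUP i\<in>I. f i) = (SUP i\<in>I. sqrt_ennreal (f i))"
proof (rule antisym)
  show "sqrt_ennreal (SUP i\<in>I. f i) \<le> (SUP i\<in>I. sqrt_ennreal (f i))"
    by (simp only: sqrt_ennreal_le_iff power2_SUP_ennreal sqrt_ennreal_power2)
  show "(SUP i\<in>I. sqrt_ennreal (f i)) \<le> sqrt_ennreal (SUP i\<in>I. f i)"
    by (rule SUP_least) (simp add: le_sqrt_ennreal_iff sqrt_ennreal_power2 SUP_upper)
qed

text \<open>A series is an integral against counting measure, so the integral inequality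
  applies.\<close>

lemma Cauchy_Schwarz_suminf_ennreal:
  fixes a b :: "nat \<Rightarrow> ennreal"
  shows "(\<Sum>n. a n * b n)\<^sup>2 \<le> (\<Sum>n. (a n)\<^sup>2) * (\<Sum>n. (b n)\<^sup>2)"
  using Cauchy_Schwarz_nn_integral[of a "count_space UNIV" b]
  by (simp add: nn_integral_count_space_nat)

text \<open>Each weight is split into two factors \<open>sqrt (w n)\<close>. This trades the square
  of a series for a series of squares, which can be integrated term by term.\<close>

lemma weighted_Cauchy_Schwarz_suminf:
  fixes w b :: "nat \<Rightarrow> real"
  assumes "\<And>n. w n \<ge> 0"
  shows "(\<Sum>n. ennreal (w n * \<bar>b n\<bar>))\<^sup>2 \<le> (\<Sum>n. ennreal (w n)) * (\<Sum>n. ennreal (w n * (b n)\<^sup>2))"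
proof -
  have "ennreal (sqrt (w n)) * ennreal (sqrt (w n) * \<bar>b n\<bar>) = ennreal (w n * \<bar>b n\<bar>)"
    "(ennreal (sqrt (w n)))\<^sup>2 = ennreal (w n)"
    "(ennreal (sqrt (w n) * \<bar>b n\<bar>))\<^sup>2 = ennreal (w n * (b n)\<^sup>2)" for n
    using assms[of n] by (simp_all add: ennreal_power power_mult_distrib ennreal_mult'[symmetric])
  then show ?thesis
    using Cauchy_Schwarz_suminf_ennreal
        [of "\<lambda>n. ennreal (sqrt (w n))" "\<lambda>n. ennreal (sqrt (w n) * \<bar>b n\<bar>)"] by simp
qed

section \<open>Suprema of continuous seminorms\<close>

text \<open>The assumptions keep only what completeness and continuity need: \<open>q\<close> is a
  supremum of continuous seminorms, and it dominates a positive multiple of the norm. The latter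
  makes \<open>q\<close> definite and turns \<open>q\<close>-Cauchy sequences into Cauchy sequences
  of the ambient space.\<close>

locale sup_seminorm =
  fixes s :: "nat \<Rightarrow> 'e::{real_normed_vector, complete_space} \<Rightarrow> real" and c :: real
  assumes s_continuous: "continuous_on UNIV (s N)"
    and s_scale: "s N (a *\<^sub>R z) = \<bar>a\<bar> * s N z"
    and s_triangle: "s N (u + v) \<le> s N u + s N v"
    and s_nonneg: "0 \<le> s N z"
    and c_pos: "c > 0"
    and norm_le_SUP: "ennreal (c * norm z) \<le> (SUP N. ennreal (s N z))"
begin

definition q :: "'e \<Rightarrow> ennreal" where
  "q z = (SUP N. ennreal (s N z))"

abbreviation V :: "'e set" where
  "V \<equiv> fin_dom q"

abbreviation d :: "'e \<Rightarrow> 'e \<Rightarrow> real" where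
  "d \<equiv> norm_dist q"

lemma norm_le_q: "ennreal (c * norm z) \<le> q z"
  using norm_le_SUP by (simp add: q_def)

lemma q_le_iff: "0 \<le> r \<Longrightarrow> q z \<le> ennreal r \<longleftrightarrow> (\<forall>N. s N z \<le> r)"
  by (simp add: q_def SUP_le_iff)

text \<open>The identity holds on the whole space, also for \<open>a = 0\<close> and infinite
  \<open>q z\<close>, because \<open>0 * \<infinity> = 0\<close> in \<open>ennreal\<close>.\<close>

lemma q_scale: "q (a *\<^sub>R z) = ennreal \<bar>a\<bar> * q z"
  by (simp add: q_def s_scale ennreal_mult s_nonneg SUP_mult_left_ennreal)

lemma q_triangle: "q (u + v) \<le> q u + q v"
  unfolding q_def
proof (rule SUP_least)
  fix N
  have "ennreal (s N (u + v)) \<le> ennreal (s N u) + ennreal (s N v)"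
    using s_triangle[of N u v] by (simp add: s_nonneg flip: ennreal_plus)
  also have "\<dots> \<le> (SUP N. ennreal (s N u)) + (SUP N. ennreal (s N v))"
    by (intro add_mono SUP_upper) auto
  finally show "ennreal (s N (u + v)) \<le> (SUP N. ennreal (s N u)) + (SUP N. ennreal (s N v))" .
qed

lemma q_measurable: "q \<in> borel_measurable borel"
  unfolding q_def
  by (intro borel_measurable_SUP measurable_compose[OF _ measurable_ennreal]
      borel_measurable_continuous_onI s_continuous) auto

lemma q_eq_0_iff: "q z = 0 \<longleftrightarrow> z = 0"
proof
  assume "q z = 0"
  then show "z = 0"
    using norm_le_q[of z] c_pos by (simp add: mult_le_0_iff)
next
  assume "z = 0"
  then show "q z = 0"
    using q_scale[of 0 0] by simp
qed

lemma subspace_V: "subspace V"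
proof (rule subspaceI)
  show "0 \<in> V"
    using q_eq_0_iff[of 0] by (simp add: fin_dom_def)
  show "u + v \<in> V" if "u \<in> V" "v \<in> V" for u v
    using that le_less_trans[OF q_triangle[of u v]] by (simp add: fin_dom_def)
  show "a *\<^sub>R u \<in> V" if "u \<in> V" for a u
    using that by (simp add: fin_dom_def q_scale ennreal_mult_less_top)
qed

lemma norm_on_subspace_V: "norm_on_subspace V q"
  unfolding norm_on_subspace_def
  using subspace_V q_eq_0_iff q_scale q_triangle by (auto simp: fin_dom_def)

text \<open>Since \<open>enn2real\<close> sends infinity to 0, \<open>d\<close> represents
  \<open>q\<close> faithfully only for differences with finite \<open>q\<close>; membership in the
  subspace \<open>V\<close> guarantees this.\<close>

lemma ennreal_d: "u \<in> V \<Longrightarrow> v \<in> V \<Longrightarrow> ennreal (d u v) = q (u - v)"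
  using subspace_diff[OF subspace_V, of u v] by (simp add: norm_dist_def fin_dom_def)

lemma d_le_iff: "u \<in> V \<Longrightarrow> v \<in> V \<Longrightarrow> 0 \<le> r \<Longrightarrow> d u v \<le> r \<longleftrightarrow> q (u - v) \<le> ennreal r"
  by (simp flip: ennreal_d)

lemma d_nonneg: "0 \<le> d u v"
  by (simp add: norm_dist_def)

lemma dist_le_d: "u \<in> V \<Longrightarrow> v \<in> V \<Longrightarrow> c * dist u v \<le> d u v"
  using norm_le_q[of "u - v"] by (simp add: dist_norm d_nonneg flip: ennreal_d)

sublocale Metric_space V d
proof
  show "0 \<le> d u v" for u v
    by (rule d_nonneg)
  show "d u v = d v u" for u v
    using q_scale[of "-1" "u - v"] by (simp add: norm_dist_def)
  show "d u v = 0 \<longleftrightarrow> u = v" if "u \<in> V" "v \<in> V" for u v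
  proof -
    have "d u v = 0 \<longleftrightarrow> ennreal (d u v) = 0"
      using d_nonneg[of u v] by (simp add: ennreal_eq_0_iff)
    then show ?thesis
      by (simp add: ennreal_d that q_eq_0_iff)
  qed
  show "d u w \<le> d u v + d v w" if "u \<in> V" "v \<in> V" "w \<in> V" for u v w
  proof -
    have "ennreal (d u w) \<le> ennreal (d u v + d v w)"
      using q_triangle[of "u - v" "v - w"] that by (simp add: ennreal_d d_nonneg)
    then show ?thesis
      using d_nonneg[of u v] d_nonneg[of v w] by (subst (asm) ennreal_le_iff) auto
  qed
qed

text \<open>The closed balls of \<open>q\<close> are closed in the ambient space, so a \<open>q\<close>-Cauchy sequence
  converges in \<open>q\<close> to its limit in the ambient space.\<close>

lemma mcomplete_V: "mcomplete"
  unfolding mcomplete_def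
proof (intro allI impI)
  fix \<sigma> assume \<sigma>: "MCauchy \<sigma>"
  then have V: "\<sigma> n \<in> V" for n
    by (auto simp: MCauchy_def)
  have "Cauchy \<sigma>"
  proof (rule metric_CauchyI)
    fix \<epsilon> :: real assume "\<epsilon> > 0"
    then have "c * \<epsilon> > 0"
      using c_pos by simp
    then obtain N where N: "d (\<sigma> m) (\<sigma> n) < c * \<epsilon>" if "m \<ge> N" "n \<ge> N" for m n
      using \<sigma> unfolding MCauchy_def by meson
    have "dist (\<sigma> m) (\<sigma> n) < \<epsilon>" if "m \<ge> N" "n \<ge> N" for m n
      using le_less_trans[OF dist_le_d[OF V V] N[OF that]] c_pos by simp
    then show "\<exists>N. \<forall>m\<ge>N. \<forall>n\<ge>N. dist (\<sigma> m) (\<sigma> n) < \<epsilon>"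
      by blast
  qed
  then obtain z where z: "\<sigma> \<longlonglongrightarrow> z"
    using Cauchy_convergent_iff convergent_def by blast
  \<comment> \<open>For fixed \<open>n\<close> the Cauchy estimate passes to the limit in
    \<open>m\<close> inside each continuous \<open>s k\<close>. The index \<open>N\<close> does not
    depend on \<open>k\<close>, so the bound survives the supremum.\<close>
  have lim: "\<exists>N. \<forall>n\<ge>N. q (\<sigma> n - z) \<le> ennreal \<epsilon>" if "\<epsilon> > 0" for \<epsilon>
  proof -
    obtain N where N: "d (\<sigma> m) (\<sigma> n) < \<epsilon>" if "m \<ge> N" "n \<ge> N" for m n
      using \<sigma> \<open>\<epsilon> > 0\<close> unfolding MCauchy_def by meson
    have "s k (\<sigma> n - z) \<le> \<epsilon>" if "n \<ge> N" for n k
    proof (rule LIMSEQ_le_const2)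
      show "(\<lambda>m. s k (\<sigma> n - \<sigma> m)) \<longlonglongrightarrow> s k (\<sigma> n - z)"
        by (rule continuous_on_tendsto_compose[OF s_continuous]) (auto intro!: tendsto_intros z)
      have "s k (\<sigma> n - \<sigma> m) \<le> \<epsilon>" if "m \<ge> N" for m
        using less_imp_le[OF N[OF \<open>n \<ge> N\<close> that]] \<open>\<epsilon> > 0\<close>
        by (simp only: d_le_iff[OF V V] q_le_iff less_imp_le)
      then show "\<exists>N. \<forall>m\<ge>N. s k (\<sigma> n - \<sigma> m) \<le> \<epsilon>"
        by blast
    qed
    then show ?thesis
      using \<open>\<epsilon> > 0\<close> by (auto simp: q_le_iff)
  qed
  \<comment> \<open>The limit differs from some \<open>\<sigma> N\<close> by a vector of finite
    \<open>q\<close>.\<close>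
  have "z \<in> V"
  proof -
    obtain N where "q (\<sigma> N - z) \<le> ennreal 1"
      using lim[of 1] by auto
    then have "\<sigma> N - z \<in> V"
      using le_less_trans[of _ "ennreal 1" \<infinity>] by (simp add: fin_dom_def)
    then show ?thesis
      using subspace_diff[OF subspace_V V[of N], of "\<sigma> N - z"] by simp
  qed
  moreover have "\<exists>N. \<forall>n\<ge>N. d (\<sigma> n) z < \<epsilon>" if "\<epsilon> > 0" for \<epsilon>
  proof -
    have half: "\<epsilon> / 2 > 0" "0 \<le> \<epsilon> / 2" "\<epsilon> / 2 < \<epsilon>"
      using \<open>\<epsilon> > 0\<close> by simp_all
    obtain N where N: "\<forall>n\<ge>N. q (\<sigma> n - z) \<le> ennreal (\<epsilon> / 2)"
      using lim[OF half(1)] by blast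
    have "d (\<sigma> n) z < \<epsilon>" if "n \<ge> N" for n
      using N that d_le_iff[OF V \<open>z \<in> V\<close> half(2)] half(3) by (blast intro: le_less_trans)
    then show ?thesis
      by blast
  qed
  ultimately show "\<exists>x. limitin mtopology \<sigma> x sequentially"
    using V by (auto simp: limit_metric_sequentially)
qed

text \<open>Domination of the norm places the \<open>d\<close>-ball of radius \<open>c * r\<close>
  inside the norm ball of radius \<open>r\<close>.\<close>

lemma continuous_inclusion: "continuous_map mtopology euclidean (\<lambda>z. z)"
proof -
  have "openin mtopology {z \<in> V. z \<in> U}" if "open U" for U
    unfolding openin_mtopology
  proof (intro conjI allI impI)
    fix x assume x: "x \<in> {z \<in> V. z \<in> U}"
    then obtain r where "r > 0" and r: "ball x r \<subseteq> U"
      using \<open>open U\<close> by (auto simp: open_contains_ball)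
    have "y \<in> ball x r" if "y \<in> mball x (c * r)" for y
      using le_less_trans[OF dist_le_d, of x y "c * r"] that c_pos by simp
    then show "\<exists>r>0. mball x r \<subseteq> {z \<in> V. z \<in> U}"
      using r \<open>r > 0\<close> c_pos by (intro exI[of _ "c * r"]) auto
  qed auto
  then show ?thesis
    by (simp add: continuous_map_def)
qed

text \<open>By linearity the bound makes \<open>f\<close> Lipschitz with constant \<open>K\<close>,
  so radius \<open>r / K\<close> in the domain serves radius \<open>r\<close> in the target.\<close>

lemma continuous_map_into_V:
  fixes f :: "'h::real_normed_vector \<Rightarrow> 'e"
  assumes "linear f" and f: "\<And>h. q (f h) \<le> ennreal (K * norm h)" and "K > 0"
  shows "range f \<subseteq> V" "continuous_map euclidean mtopology f"
proof -
  have "q (f h) < \<infinity>" for h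
    by (rule le_less_trans[OF f]) simp
  then show V: "range f \<subseteq> V"
    by (auto simp: fin_dom_def)
  then have fV: "f h \<in> V" for h
    by blast
  have "open {h. f h \<in> U}" if U: "openin mtopology U" for U
    unfolding open_contains_ball
  proof
    fix h assume "h \<in> {h. f h \<in> U}"
    then obtain r where "r > 0" and r: "mball (f h) r \<subseteq> U"
      using U unfolding openin_mtopology by blast
    have "f g \<in> mball (f h) r" if "g \<in> ball h (r / K)" for g
    proof -
      have "d (f h) (f g) \<le> K * norm (h - g)"
        using f[of "h - g"] \<open>K > 0\<close> d_le_iff[of "f h" "f g" "K * norm (h - g)"] fV
        unfolding linear_diff[OF \<open>linear f\<close>] by simp
      also have "\<dots> < r"
        using that \<open>K > 0\<close> by (simp add: dist_norm field_simps)
      finally show ?thesis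
        using fV by simp
    qed
    then show "\<exists>\<epsilon>>0. ball h \<epsilon> \<subseteq> {h. f h \<in> U}"
      using r \<open>r > 0\<close> \<open>K > 0\<close> by (intro exI[of _ "r / K"]) auto
  qed
  then show "continuous_map euclidean mtopology f"
    using V by (auto simp: continuous_map_def)
qed

lemma mbounded_imp_q_bounded:
  assumes "mbounded A"
  obtains R where "R \<ge> 0" "\<And>z. z \<in> A \<Longrightarrow> q z \<le> ennreal R"
proof -
  obtain x B where A: "A \<subseteq> mcball x B"
    using assms by (auto simp: mbounded_def)
  \<comment> \<open>The second summand moves the centre from \<open>x\<close> to the origin; the
    \<open>max\<close> covers a negative \<open>B\<close>, which can occur for empty
    \<open>A\<close>.\<close>
  define R where "R = max B 0 + d x 0"
  have "R \<ge> 0"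
    by (simp add: R_def)
  have "q z \<le> ennreal R" if "z \<in> A" for z
  proof -
    have "z \<in> V" "x \<in> V" "d x z \<le> B" "0 \<in> V"
      using A that subspace_0[OF subspace_V] by auto
    then have "d z 0 \<le> R"
      using triangle[of z x 0] commute[of z x] by (simp add: R_def)
    then show ?thesis
      using \<open>z \<in> V\<close> \<open>0 \<in> V\<close> \<open>R \<ge> 0\<close> d_le_iff[of z 0 R] by simp
  qed
  then show ?thesis
    using \<open>R \<ge> 0\<close> that by blast
qed

end

section \<open>Orthonormal expansions\<close>

text \<open>For orthonormal \<open>b\<close> this is the orthogonal projection onto the span of the
  first \<open>N\<close> vectors.\<close>

definition partial_expansion :: "(nat \<Rightarrow> 'a::real_inner) \<Rightarrow> nat \<Rightarrow> 'a \<Rightarrow> 'a" where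
  "partial_expansion b N z = (\<Sum>n<N. (b n \<bullet> z) *\<^sub>R b n)"

lemma linear_partial_expansion: "linear (partial_expansion b N)"
  by (auto simp: linear_iff partial_expansion_def inner_add_right scaleR_add_left sum.distrib
      scaleR_right.sum)

lemma orthonormal_basis_seq_inner:
  "orthonormal_basis_seq b \<Longrightarrow> b m \<bullet> b n = (if m = n then 1 else 0)"
  by (auto simp: orthonormal_basis_seq_def orthonormal_basis_def inj_eq pairwise_def
      orthogonal_def dot_square_norm)

lemma norm_sum_orthonormal:
  assumes "orthonormal_basis_seq b" "finite I"
  shows "(norm (\<Sum>n\<in>I. f n *\<^sub>R b n))\<^sup>2 = (\<Sum>n\<in>I. (f n)\<^sup>2)"
  using assms(2) unfolding power2_norm_eq_inner
  by (simp add: inner_sum_left inner_sum_right power2_eq_square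
      orthonormal_basis_seq_inner[OF assms(1)] if_distrib[of "(*) _"] cong: if_cong)

text \<open>The projection \<open>?P\<close> satisfies
  \<open>?P \<bullet> ?P = ?P \<bullet> z\<close>, so removing it lowers the squared norm by exactly
  \<open>?P \<bullet> ?P\<close>.\<close>

lemma norm_diff_partial_expansion_le:
  assumes "orthonormal_basis_seq b"
  shows "norm (z - partial_expansion b N z) \<le> norm z"
proof -
  let ?P = "partial_expansion b N z"
  have "?P \<bullet> ?P = (\<Sum>n<N. (b n \<bullet> z)\<^sup>2)"
    using norm_sum_orthonormal[OF assms, of "{..<N}" "\<lambda>n. b n \<bullet> z"]
    by (simp add: partial_expansion_def power2_norm_eq_inner)
  moreover have "?P \<bullet> z = (\<Sum>n<N. (b n \<bullet> z)\<^sup>2)"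
    by (simp add: partial_expansion_def inner_sum_left power2_eq_square)
  ultimately have "(z - ?P) \<bullet> (z - ?P) \<le> z \<bullet> z"
    by (simp add: inner_diff_left inner_diff_right inner_commute sum_nonneg)
  then show ?thesis
    by (simp add: norm_le)
qed

text \<open>On the span of the basis the expansion is eventually exact. The previous bound is
  uniform in \<open>N\<close>, so convergence extends to the closure of the span.\<close>

lemma partial_expansion_tendsto:
  assumes b: "orthonormal_basis_seq b"
  shows "(\<lambda>N. partial_expansion b N z) \<longlonglongrightarrow> z"
proof (rule LIMSEQ_I)
  fix \<epsilon> :: real assume "\<epsilon> > 0"
  have "z \<in> closure (span (range b))"
    using b by (simp add: orthonormal_basis_seq_def orthonormal_basis_def)
  then obtain y where y: "y \<in> span (range b)" "dist y z < \<epsilon>"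
    using \<open>\<epsilon> > 0\<close> by (auto simp: closure_approachable)
  have "\<exists>M. \<forall>N\<ge>M. partial_expansion b N y = y"
    using y(1)
  proof (induction rule: span_induct_alt)
    case base
    then show ?case
      using linear_0[OF linear_partial_expansion] by blast
  next
    case (step a x u)
    then obtain m M where "x = b m" and M: "\<forall>N\<ge>M. partial_expansion b N u = u"
      by blast
    have "partial_expansion b N (b m) = b m" if "N > m" for N
      using that
      by (simp add: partial_expansion_def orthonormal_basis_seq_inner[OF b]
          if_distrib[of "\<lambda>c. c *\<^sub>R _"] cong: if_cong)
    then have "\<forall>N\<ge>max M (Suc m). partial_expansion b N (a *\<^sub>R x + u) = a *\<^sub>R x + u"
      using M by (simp add: \<open>x = b m\<close> linear_add[OF linear_partial_expansion]
          linear_cmul[OF linear_partial_expansion])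
    then show ?case
      by blast
  qed
  then obtain M where M: "partial_expansion b N y = y" if "N \<ge> M" for N
    by blast
  have "norm (partial_expansion b N z - z) < \<epsilon>" if "N \<ge> M" for N
  proof -
    \<comment> \<open>Because \<open>y\<close> is reproduced exactly, the error at \<open>z\<close>
      is, up to sign, the error at \<open>z - y\<close>.\<close>
    have "partial_expansion b N z - z = - ((z - y) - partial_expansion b N (z - y))"
      by (simp add: linear_diff[OF linear_partial_expansion] M that)
    then have "norm (partial_expansion b N z - z) \<le> norm (z - y)"
      using norm_diff_partial_expansion_le[OF b, of "z - y" N] by (metis norm_minus_cancel)
    then show ?thesis
      using y(2) by (simp add: dist_norm norm_minus_commute)
  qed
  then show "\<exists>M. \<forall>N\<ge>M. norm (partial_expansion b N z - z) < \<epsilon>"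
    by blast
qed

text \<open>From index \<open>N\<close> on all weights are at least \<open>\<alpha> N\<close>; this
  is applied to finite tails before passing to the limit. For \<open>N = 0\<close> it bounds the
  norm of \<open>z\<close>, for large \<open>N\<close> it makes the tail small.\<close>

lemma norm_expansion_tail_le:
  assumes b: "orthonormal_basis_seq b" and "incseq \<alpha>" "\<And>n. \<alpha> n > 0"
    and le: "\<And>M. (\<Sum>n<M. \<alpha> n * (b n \<bullet> z)\<^sup>2) \<le> C"
  shows "\<alpha> N * (norm (z - partial_expansion b N z))\<^sup>2 \<le> C"
proof (rule LIMSEQ_le_const2)
  show "(\<lambda>M. \<alpha> N * (norm (partial_expansion b M z - partial_expansion b N z))\<^sup>2)
      \<longlonglongrightarrow> \<alpha> N * (norm (z - partial_expansion b N z))\<^sup>2"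
    by (intro tendsto_intros partial_expansion_tendsto[OF b])
  have "\<alpha> N * (norm (partial_expansion b M z - partial_expansion b N z))\<^sup>2 \<le> C" if "M \<ge> N" for M
  proof -
    have "partial_expansion b M z - partial_expansion b N z = (\<Sum>n\<in>{N..<M}. (b n \<bullet> z) *\<^sub>R b n)"
      using that sum_diff_nat_ivl[of 0 N M "\<lambda>n. (b n \<bullet> z) *\<^sub>R b n"]
      by (simp add: partial_expansion_def atLeast0LessThan)
    then have "\<alpha> N * (norm (partial_expansion b M z - partial_expansion b N z))\<^sup>2
        = (\<Sum>n\<in>{N..<M}. \<alpha> N * (b n \<bullet> z)\<^sup>2)"
      by (simp add: norm_sum_orthonormal[OF b] sum_distrib_left)
    also have "\<dots> \<le> (\<Sum>n\<in>{N..<M}. \<alpha> n * (b n \<bullet> z)\<^sup>2)"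
      using \<open>incseq \<alpha>\<close> by (intro sum_mono mult_right_mono) (auto simp: incseq_def)
    also have "\<dots> \<le> (\<Sum>n<M. \<alpha> n * (b n \<bullet> z)\<^sup>2)"
      using assms(3) by (intro sum_mono2) (auto simp: less_imp_le)
    also have "\<dots> \<le> C"
      by (rule le)
    finally show ?thesis .
  qed
  then show "\<exists>K. \<forall>M\<ge>K. \<alpha> N * (norm (partial_expansion b M z - partial_expansion b N z))\<^sup>2 \<le> C"
    by blast
qed

text \<open>Induction on the dimension: each step adds a compact segment as a Minkowski
  summand.\<close>

lemma compact_box_span:
  fixes b :: "nat \<Rightarrow> 'a::real_normed_vector"
  shows "compact {\<Sum>n<N. f n *\<^sub>R b n | f. \<forall>n<N. \<bar>f n\<bar> \<le> R}"
proof (induction N)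
  case 0
  then show ?case by simp
next
  case (Suc N)
  let ?S = "\<lambda>N. {\<Sum>n<N. f n *\<^sub>R b n | f. \<forall>n<N. \<bar>f n\<bar> \<le> R}"
  have "compact ((\<lambda>t. t *\<^sub>R b N) ` {-R..R})"
    by (intro compact_continuous_image continuous_intros) auto
  then have "compact (\<Union>x\<in>?S N. \<Union>y\<in>(\<lambda>t. t *\<^sub>R b N) ` {-R..R}. {x + y})"
    by (rule compact_sums'[OF Suc.IH])
  also have "(\<Union>x\<in>?S N. \<Union>y\<in>(\<lambda>t. t *\<^sub>R b N) ` {-R..R}. {x + y}) = ?S (Suc N)"
  proof (intro equalityI subsetI)
    fix z assume "z \<in> (\<Union>x\<in>?S N. \<Union>y\<in>(\<lambda>t. t *\<^sub>R b N) ` {-R..R}. {x + y})"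
    then obtain f t where f: "\<forall>n<N. \<bar>f n\<bar> \<le> R" "t \<in> {-R..R}"
        "z = (\<Sum>n<N. f n *\<^sub>R b n) + t *\<^sub>R b N"
      by blast
    then show "z \<in> ?S (Suc N)"
      by (intro CollectI exI[of _ "f(N := t)"]) (auto simp: less_Suc_eq)
  next
    fix z assume "z \<in> ?S (Suc N)"
    then obtain f where f: "\<forall>n<Suc N. \<bar>f n\<bar> \<le> R" "z = (\<Sum>n<Suc N. f n *\<^sub>R b n)"
      by blast
    have "(\<Sum>n<N. f n *\<^sub>R b n) \<in> ?S N" "f N \<in> {-R..R}"
      using f(1) by (auto simp: abs_le_iff)
    with f(2) show "z \<in> (\<Union>x\<in>?S N. \<Union>y\<in>(\<lambda>t. t *\<^sub>R b N) ` {-R..R}. {x + y})"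
      by (intro UN_I[of "\<Sum>n<N. f n *\<^sub>R b n"] UN_I[of "f N *\<^sub>R b N"]) auto
  qed
  finally show ?case .
qed

text \<open>Total boundedness by three errors of \<open>\<epsilon> / 3\<close>: from the closure to
  \<open>A\<close>, from \<open>A\<close> to \<open>K\<close>, and from \<open>K\<close> to a finite
  net of \<open>K\<close>.\<close>

lemma compact_closure_if_approx_compact:
  fixes A :: "'a::{real_normed_vector, complete_space} set"
  assumes "\<And>\<epsilon>. \<epsilon> > 0 \<Longrightarrow> \<exists>K. compact K \<and> (\<forall>z\<in>A. \<exists>y\<in>K. dist y z < \<epsilon>)"
  shows "compact (closure A)"
  unfolding compact_eq_totally_bounded
proof (intro conjI allI impI)
  show "uniform_space_class.complete (closure A)"
    by (simp add: complete_eq_closed)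
  fix \<epsilon> :: real assume "\<epsilon> > 0"
  then obtain K where "compact K" and K: "\<And>z. z \<in> A \<Longrightarrow> \<exists>y\<in>K. dist y z < \<epsilon> / 3"
    using assms[of "\<epsilon> / 3"] by auto
  then obtain F where "finite F" and F: "K \<subseteq> (\<Union>x\<in>F. ball x (\<epsilon> / 3))"
    using \<open>\<epsilon> > 0\<close> by (auto simp: compact_eq_totally_bounded dest: spec[of _ "\<epsilon> / 3"])
  have "z \<in> (\<Union>x\<in>F. ball x \<epsilon>)" if z: "z \<in> closure A" for z
  proof -
    obtain a where "a \<in> A" "dist a z < \<epsilon> / 3"
      using closure_approachableD[OF z, of "\<epsilon> / 3"] \<open>\<epsilon> > 0\<close> by (auto simp: dist_commute)
    moreover obtain y where "y \<in> K" "dist y a < \<epsilon> / 3"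
      using K \<open>a \<in> A\<close> by blast
    moreover obtain x where "x \<in> F" "dist x y < \<epsilon> / 3"
      using F \<open>y \<in> K\<close> by (auto simp: subset_iff)
    ultimately have "dist x z < \<epsilon>"
      using dist_triangle[of x z y] dist_triangle[of y z a] by linarith
    then show ?thesis
      using \<open>x \<in> F\<close> by auto
  qed
  then show "\<exists>F. finite F \<and> closure A \<subseteq> (\<Union>x\<in>F. ball x \<epsilon>)"
    using \<open>finite F\<close> by blast
qed

text \<open>One \<open>N\<close> makes the expansion tails smaller than \<open>\<epsilon>\<close>
  for all \<open>z\<close> in \<open>A\<close>, while the truncated expansions stay in a compact
  box.\<close>

lemma compact_closure_weighted_ellipsoid:
  fixes b :: "nat \<Rightarrow> 'e::{real_inner, complete_space}"
  assumes b: "orthonormal_basis_seq b" and \<alpha>: "incseq \<alpha>" "\<And>n. \<alpha> n > 0"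
    and lim: "filterlim \<alpha> at_top sequentially"
    and A: "\<And>z M. z \<in> A \<Longrightarrow> (\<Sum>n<M. \<alpha> n * (b n \<bullet> z)\<^sup>2) \<le> C"
  shows "compact (closure A)"
proof (rule compact_closure_if_approx_compact)
  fix \<epsilon> :: real assume "\<epsilon> > 0"
  then have "\<forall>\<^sub>F N in sequentially. \<alpha> N > C / \<epsilon>\<^sup>2"
    using lim by (simp add: filterlim_at_top_dense)
  then obtain N where N: "\<alpha> N > C / \<epsilon>\<^sup>2"
    by (auto simp: eventually_sequentially)
  \<comment> \<open>The tail estimate at index 0 gives
    \<open>\<alpha> 0 * (norm z)\<^sup>2 \<le> C\<close>, so \<open>R\<close> bounds the norm and
    hence every coefficient.\<close>
  define R where "R = sqrt (C / \<alpha> 0)"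
  have "\<exists>y\<in>{\<Sum>n<N. f n *\<^sub>R b n | f. \<forall>n<N. \<bar>f n\<bar> \<le> R}. dist y z < \<epsilon>" if "z \<in> A" for z
  proof (rule bexI)
    have tail: "\<alpha> M * (norm (z - partial_expansion b M z))\<^sup>2 \<le> C" for M
      by (rule norm_expansion_tail_le[OF b \<alpha> A[OF that]])
    have "\<alpha> N * (norm (z - partial_expansion b N z))\<^sup>2 < \<alpha> N * \<epsilon>\<^sup>2"
      using tail[of N] N \<open>\<epsilon> > 0\<close> by (simp add: field_simps)
    then show "dist (partial_expansion b N z) z < \<epsilon>"
      using \<alpha>(2)[of N] \<open>\<epsilon> > 0\<close>
      by (simp add: dist_norm norm_minus_commute power_less_imp_less_base)
    have "(norm z)\<^sup>2 \<le> C / \<alpha> 0"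
      using tail[of 0] \<alpha>(2)[of 0] by (simp add: partial_expansion_def field_simps)
    then have "norm z \<le> R"
      unfolding R_def by (rule real_le_rsqrt)
    moreover have "norm (b n) = 1" for n
      using b by (auto simp: orthonormal_basis_seq_def orthonormal_basis_def)
    ultimately have "\<forall>n<N. \<bar>b n \<bullet> z\<bar> \<le> R"
      using Cauchy_Schwarz_ineq2[of "b _" z] by (metis mult_1 order_trans)
    then show "partial_expansion b N z \<in> {\<Sum>n<N. f n *\<^sub>R b n | f. \<forall>n<N. \<bar>f n\<bar> \<le> R}"
      unfolding partial_expansion_def by (intro CollectI exI[of _ "\<lambda>n. b n \<bullet> z"]) simp
  qed
  then show "\<exists>K. compact K \<and> (\<forall>z\<in>A. \<exists>y\<in>K. dist y z < \<epsilon>)"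
    using compact_box_span by blast
qed

section \<open>Truncations of the weighted norm\<close>

text \<open>Cutting both series off at \<open>N\<close> gives continuous seminorms with supremum \<open>q\<^sub>x\<close>.\<close>

definition truncation ::
    "(nat \<Rightarrow> 'e \<Rightarrow> real) \<Rightarrow> (nat \<Rightarrow> 'e \<Rightarrow> real) \<Rightarrow> (nat \<Rightarrow> real) \<Rightarrow> (nat \<Rightarrow> real) \<Rightarrow> nat \<Rightarrow> 'e \<Rightarrow> real"
  where "truncation p r a w N z =
    sqrt ((\<Sum>n<N. a n * (p n z)\<^sup>2) + (\<Sum>n<N. w n * \<bar>r n z\<bar>)\<^sup>2)"

text \<open>Both partial sums increase with \<open>N\<close>, so their suprema can be taken along a
  common index; squaring and \<open>sqrt_ennreal\<close> commute with suprema.\<close>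

lemma SUP_truncation:
  assumes "\<And>n. a n \<ge> 0" "\<And>n. w n \<ge> 0"
  shows "(SUP N. ennreal (truncation p r a w N z)) =
    sqrt_ennreal ((\<Sum>n. ennreal (a n * (p n z)\<^sup>2)) + (\<Sum>n. ennreal (w n * \<bar>r n z\<bar>))\<^sup>2)"
proof -
  let ?A = "\<lambda>N. \<Sum>n<N. a n * (p n z)\<^sup>2" and ?B = "\<lambda>N. \<Sum>n<N. w n * \<bar>r n z\<bar>"
  have nonneg: "?A N \<ge> 0" "?B N \<ge> 0" for N
    using assms by (auto intro: sum_nonneg)
  have mono: "?A M \<le> ?A N" "?B M \<le> ?B N" if "M \<le> N" for M N
    using that assms by (auto intro!: sum_mono2)
  have inc: "incseq (\<lambda>N. ennreal (?A N))" "incseq (\<lambda>N. (ennreal (?B N))\<^sup>2)"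
    using mono by (auto simp: incseq_def intro!: power_mono ennreal_leI)
  have "(\<Sum>n. ennreal (a n * (p n z)\<^sup>2)) + (\<Sum>n. ennreal (w n * \<bar>r n z\<bar>))\<^sup>2
      = (SUP N. ennreal (?A N)) + (SUP N. ennreal (?B N))\<^sup>2"
    using assms by (simp add: suminf_eq_SUP)
  also have "\<dots> = (SUP N. ennreal (?A N) + (ennreal (?B N))\<^sup>2)"
    by (simp only: power2_SUP_ennreal ennreal_SUP_add[OF inc])
  also have "sqrt_ennreal \<dots> = (SUP N. sqrt_ennreal (ennreal (?A N) + (ennreal (?B N))\<^sup>2))"
    by (rule sqrt_ennreal_SUP)
  also have "\<dots> = (SUP N. ennreal (truncation p r a w N z))"
    using nonneg
    by (simp add: truncation_def ennreal_power sqrt_ennreal_ennreal flip: ennreal_plus)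
  finally show ?thesis ..
qed

lemma truncation_nonneg:
  assumes "\<And>n. a n \<ge> 0"
  shows "0 \<le> truncation p r a w N z"
  using assms by (simp add: truncation_def sum_nonneg)

lemma truncation_scale:
  assumes "\<And>n. linear (p n)" "\<And>n. linear (r n)"
  shows "truncation p r a w N (t *\<^sub>R z) = \<bar>t\<bar> * truncation p r a w N z"
proof -
  have "(\<Sum>n<N. a n * (p n (t *\<^sub>R z))\<^sup>2) + (\<Sum>n<N. w n * \<bar>r n (t *\<^sub>R z)\<bar>)\<^sup>2
      = t\<^sup>2 * ((\<Sum>n<N. a n * (p n z)\<^sup>2) + (\<Sum>n<N. w n * \<bar>r n z\<bar>)\<^sup>2)"
    by (simp add: linear_cmul[OF assms(1)] linear_cmul[OF assms(2)] power_mult_distrib abs_mult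
        mult.left_commute[of _ "t\<^sup>2"] mult.left_commute[of _ "\<bar>t\<bar>"] distrib_left flip: sum_distrib_left)
  then show ?thesis
    by (simp add: truncation_def real_sqrt_mult)
qed

text \<open>The truncation is the Euclidean length of the pair formed by a weighted l2 seminorm
  \<open>A\<close> and a weighted l1 seminorm \<open>B\<close>. Their triangle inequalities combine
  by monotonicity and the triangle inequality in the plane.\<close>

lemma truncation_triangle:
  assumes "\<And>n. linear (p n)" "\<And>n. linear (r n)" "\<And>n. a n \<ge> 0" "\<And>n. w n \<ge> 0"
  shows "truncation p r a w N (u + v) \<le> truncation p r a w N u + truncation p r a w N v"
proof -
  define A where "A z = L2_set (\<lambda>n. sqrt (a n) * p n z) {..<N}" for z
  define B where "B z = (\<Sum>n<N. w n * \<bar>r n z\<bar>)" for z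
  have eq: "truncation p r a w N z = sqrt ((A z)\<^sup>2 + (B z)\<^sup>2)" for z
    using assms(3)
    by (simp add: truncation_def A_def B_def L2_set_def power_mult_distrib sum_nonneg)
  have A: "A (u + v) \<le> A u + A v"
    unfolding A_def linear_add[OF assms(1)] distrib_left by (rule L2_set_triangle_ineq)
  have "B (u + v) \<le> (\<Sum>n<N. w n * \<bar>r n u\<bar> + w n * \<bar>r n v\<bar>)"
    unfolding B_def linear_add[OF assms(2)] distrib_left[symmetric]
    by (intro sum_mono mult_left_mono assms(4) abs_triangle_ineq)
  then have B: "B (u + v) \<le> B u + B v"
    by (simp add: B_def sum.distrib)
  have "0 \<le> A (u + v)" "0 \<le> B (u + v)"
    using assms(4) by (auto simp: A_def B_def intro: sum_nonneg)
  then have "sqrt ((A (u + v))\<^sup>2 + (B (u + v))\<^sup>2) \<le> sqrt ((A u + A v)\<^sup>2 + (B u + B v)\<^sup>2)"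
    using A B by (intro real_sqrt_le_mono add_mono power_mono) auto
  also have "\<dots> \<le> sqrt ((A u)\<^sup>2 + (B u)\<^sup>2) + sqrt ((A v)\<^sup>2 + (B v)\<^sup>2)"
    by (rule real_sqrt_sum_squares_triangle_ineq)
  finally show ?thesis
    by (simp add: eq)
qed

lemma truncation_continuous:
  assumes "\<And>n. continuous_on UNIV (p n)" "\<And>n. continuous_on UNIV (r n)"
  shows "continuous_on UNIV (truncation p r a w N)"
  unfolding truncation_def by (intro continuous_intros assms)

text \<open>The exponent serves both series of \<open>q\<close> on \<open>H\<close>:
  \<open>k = 2\<close> for the first and \<open>k = 1\<close> for the second.\<close>

lemma suminf_weighted_powers_le:
  assumes "\<And>n. \<bar>f n\<bar> \<le> c" "\<And>n. w n \<ge> 0" "summable w"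
  shows "(\<Sum>n. ennreal (w n * \<bar>f n\<bar> ^ k)) \<le> ennreal (suminf w * c ^ k)"
proof -
  have "c \<ge> 0"
    using assms(1)[of 0] by simp
  have "(\<Sum>n. ennreal (w n * \<bar>f n\<bar> ^ k)) \<le> (\<Sum>n. ennreal (w n * c ^ k))"
    using assms by (intro suminf_le ennreal_leI mult_left_mono power_mono) auto
  also have "\<dots> = ennreal (\<Sum>n. w n * c ^ k)"
    using assms \<open>c \<ge> 0\<close> by (intro suminf_ennreal2 summable_mult2) auto
  also have "\<dots> = ennreal (suminf w * c ^ k)"
    using assms by (simp add: suminf_mult2)
  finally show ?thesis .
qed

lemma summable_half_powers: "summable (\<lambda>n. 2 powr (- (real n + 1) / 2))"
proof -
  have "2 powr (- (real n + 1) / 2) = 2 powr (-1/2) * (2 powr (-1/2)) ^ n" for n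
    by (simp add: powr_realpow[symmetric] powr_powr powr_add[symmetric] field_simps)
  moreover have "2 powr (-1/2) < (1::real)"
    by (simp add: powr_less_one)
  ultimately show ?thesis
    by (simp add: summable_mult summable_geometric)
qed

text \<open>The topology of \<open>Ex\<close> need not be the ambient one, so its metric structure
  is expressed by \<open>Metric_space\<close> on a carrier set.\<close>

theorem proposition3p3:
  fixes j :: "'h::{real_inner, polish_space} \<Rightarrow> 'e::{real_inner, complete_space}"
    and \<psi> :: "'h \<Rightarrow> complex"
    and \<nu> :: "real \<Rightarrow> 'e measure"
    and e ex :: "nat \<Rightarrow> 'h"
    and lam \<alpha> :: "nat \<Rightarrow> real"
    and x :: 'e
    and t :: real
    and q :: "'e \<Rightarrow> ennreal"
    and Ex :: "'e set"
    and d :: "'e \<Rightarrow> 'e \<Rightarrow> real"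
  assumes embedding: "continuous_dense_embedding j"
    and HS: "hilbert_schmidt j"
    and psi_cont: "continuous_on UNIV \<psi>"
    and psi_negdef: "negative_definite \<psi>"
    and psi_0: "\<psi> 0 = 0"
    and nu_prob: "\<And>s. s > 0 \<Longrightarrow> prob_space (\<nu> s) \<and> sets (\<nu> s) = sets borel"
    and nu_char: "\<And>s \<xi>. s > 0 \<Longrightarrow> \<xi> \<in> dual_in j \<Longrightarrow>
          (\<integral>z. exp (\<i> * complex_of_real (dual_pairing j \<xi> z)) \<partial>(\<nu> s))
            = exp (- complex_of_real s * \<psi> \<xi>)"
    and H_i: "\<exists>C>0. \<forall>\<xi>\<in>dual_in j. \<forall>s>0.
          (\<integral>\<^sup>+z. ennreal ((dual_pairing j \<xi> z)\<^sup>2) \<partial>(\<nu> s)) \<le> ennreal (C * (1 + s\<^sup>2) * (norm \<xi>)\<^sup>2)"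
    and H_ii: "\<And>s. s > 0 \<Longrightarrow> range j \<in> null_sets (\<nu> s)"
    and e_basis: "orthonormal_basis_seq e" "\<And>n. e n \<in> dual_in j"
    and lam_pos: "\<And>n. lam n > 0"
    and lam_summable: "summable lam"
    and ebar_basis: "orthonormal_basis_seq (\<lambda>n. j (e n) /\<^sub>R sqrt (lam n))"
    and e_pairing: "\<And>n z. lam n * dual_pairing j (e n) z = j (e n) \<bullet> z"
    and alpha_pos: "\<And>n. \<alpha> n > 0"
    and alpha_mono: "incseq \<alpha>"
    and alpha_lim: "filterlim \<alpha> at_top sequentially"
    and alpha_lam_summable: "summable (\<lambda>n. \<alpha> n * lam n)"
    and x_notin_H: "x \<notin> range j"
    and ex_basis: "orthonormal_basis_seq ex" "\<And>n. ex n \<in> dual_in j"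
    and ex_separates: "\<And>y z. y \<noteq> z \<Longrightarrow> \<exists>n. dual_pairing j (ex n) y \<noteq> dual_pairing j (ex n) z"
    and ex_large: "\<And>n. dual_pairing j (ex n) x \<ge> 2 powr ((real n + 1) / 2)"
    and q_eq: "q = q_fun j e lam \<alpha> ex"
    and Ex_eq: "Ex = fin_dom q"
    and d_eq: "d = norm_dist q"
    and t_pos: "t > 0"
  shows
    \<comment> \<open>(i)\<close>
    "(q \<in> borel_measurable (\<nu> t) \<and> (\<integral>\<^sup>+z. (q z)\<^sup>2 \<partial>(\<nu> t)) < \<infinity> \<and>
      emeasure (\<nu> t) Ex = 1 \<and> range (\<lambda>h. j h + x) \<in> null_sets (\<nu> t)) \<and>
    \<comment> \<open>the normed space structure of \<open>(Ex, q)\<close>, with its metric \<open>d\<close>\<close>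
     (norm_on_subspace Ex q \<and> Metric_space Ex d) \<and>
    \<comment> \<open>(ii)\<close>
     (range j \<subseteq> Ex \<and> continuous_map euclidean (Metric_space.mtopology Ex d) j) \<and>
    \<comment> \<open>(iii); the bare norm inequality needs the normalisation \<open>\<alpha> 0 \<ge> 1\<close>\<close>
     ((\<forall>z. ennreal (sqrt (\<alpha> 0) * norm z) \<le> q z) \<and>
      (1 \<le> \<alpha> 0 \<longrightarrow> (\<forall>z. ennreal (norm z) \<le> q z)) \<and>
      Metric_space.mcomplete Ex d \<and>
      continuous_map (Metric_space.mtopology Ex d) euclidean (\<lambda>z. z) \<and>
      (\<forall>A. A \<subseteq> Ex \<longrightarrow> Metric_space.mbounded Ex d A \<longrightarrow> compact (closure A)))"
proof -
  define p where "p n = dual_pairing j (e n)" for n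
  define r where "r n = dual_pairing j (ex n)" for n
  define a where "a n = \<alpha> n * lam n" for n
  define w where "w n = 2 powr (- (real n + 1) / 2)" for n
  define b where "b n = j (e n) /\<^sub>R sqrt (lam n)" for n
  have a_nonneg: "a n \<ge> 0" and w_nonneg: "w n \<ge> 0" for n
    using alpha_pos[of n] lam_pos[of n] by (simp_all add: a_def w_def)
  have a_summable: "summable a" and w_summable: "summable w"
    using alpha_lam_summable summable_half_powers unfolding a_def[abs_def] w_def[abs_def] .
  have b: "orthonormal_basis_seq b"
    using ebar_basis unfolding b_def[abs_def] .
  have p: "bounded_linear (p n)" "p n (j h) = e n \<bullet> h"
    and r: "bounded_linear (r n)" "r n (j h) = ex n \<bullet> h" for n h
    using dual_pairing[OF embedding] e_basis(2) ex_basis(2) by (simp_all add: p_def r_def)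
  have cont [continuous_intros]: "continuous_on UNIV (p n)" "continuous_on UNIV (r n)" for n
    using p r by (auto intro: linear_continuous_on)
  have unit: "norm (e n) = 1" "norm (ex n) = 1" for n
    using e_basis(1) ex_basis(1) by (auto simp: orthonormal_basis_seq_def orthonormal_basis_def)
  \<comment> \<open>Pairing with \<open>e n\<close> and the inner product with \<open>b n\<close>
    differ by the factor \<open>sqrt (lam n)\<close>, which turns the first sum into the ellipsoid
    sum of \<open>b\<close>. The square of the second sum is nonnegative and is dropped.\<close>
  have ellipsoid: "(\<Sum>n<M. \<alpha> n * (b n \<bullet> z)\<^sup>2) \<le> R\<^sup>2" if "truncation p r a w M z \<le> R" for M z R
  proof -
    have "b n \<bullet> z = sqrt (lam n) * p n z" for n
      using lam_pos[of n] real_div_sqrt[of "lam n"]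
      by (simp add: b_def p_def divide_inverse[symmetric] flip: e_pairing)
         (simp add: field_simps)
    then have "(\<Sum>n<M. \<alpha> n * (b n \<bullet> z)\<^sup>2) = (\<Sum>n<M. a n * (p n z)\<^sup>2)"
      using lam_pos by (simp add: a_def power_mult_distrib less_imp_le mult.assoc)
    then show ?thesis
      using sqrt_le_D[OF that[unfolded truncation_def]] by (smt (verit) zero_le_power2)
  qed

  \<comment> \<open>The weighted norm as a supremum of truncations\<close>
  interpret S: sup_seminorm "truncation p r a w" "sqrt (\<alpha> 0)"
  proof
    show "continuous_on UNIV (truncation p r a w N)" for N
      by (intro truncation_continuous cont)
    show "truncation p r a w N (t *\<^sub>R z) = \<bar>t\<bar> * truncation p r a w N z" for N t z
      using p(1) r(1) by (intro truncation_scale bounded_linear.linear)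
    show "truncation p r a w N (u + v) \<le> truncation p r a w N u + truncation p r a w N v" for N u v
      using p(1) r(1) a_nonneg w_nonneg by (intro truncation_triangle bounded_linear.linear)
    show "0 \<le> truncation p r a w N z" for N z
      using a_nonneg by (rule truncation_nonneg)
    show "sqrt (\<alpha> 0) > 0"
      using alpha_pos by simp
    show "ennreal (sqrt (\<alpha> 0) * norm z) \<le> (SUP N. ennreal (truncation p r a w N z))" for z
    proof (cases "SUP N. ennreal (truncation p r a w N z)")
      case (real C)
      have "truncation p r a w N z \<le> C" for N
        using SUP_upper[of N UNIV "\<lambda>N. ennreal (truncation p r a w N z)"] real by simp
      \<comment> \<open>At index 0 the partial expansion is empty, so the tail is \<open>z\<close>
        itself; this is the source of the constant \<open>sqrt (\<alpha> 0)\<close>.\<close>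
      then have "\<alpha> 0 * (norm (z - partial_expansion b 0 z))\<^sup>2 \<le> C\<^sup>2"
        by (intro norm_expansion_tail_le[OF b alpha_mono alpha_pos] ellipsoid)
      then have "(sqrt (\<alpha> 0) * norm z)\<^sup>2 \<le> C\<^sup>2"
        using alpha_pos[of 0] by (simp add: partial_expansion_def power_mult_distrib)
      then have "sqrt (\<alpha> 0) * norm z \<le> C"
        using real(1) by (rule power2_le_imp_le)
      then show ?thesis
        unfolding real(2) by (rule ennreal_leI)
    next
      case top
      then show ?thesis
        by (simp only: top_greatest)
    qed
  qed

  have q: "q = S.q"
    unfolding fun_eq_iff S.q_def SUP_truncation[OF a_nonneg w_nonneg] q_eq q_fun_def
      p_def r_def a_def w_def by (intro allI refl)
  have q_power2: "(q z)\<^sup>2 = (\<Sum>n. ennreal (a n * (p n z)\<^sup>2)) + (\<Sum>n. ennreal (w n * \<bar>r n z\<bar>))\<^sup>2" for z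
    unfolding q S.q_def SUP_truncation[OF a_nonneg w_nonneg] by (rule sqrt_ennreal_power2)
  have Ex: "Ex = S.V" and d: "d = S.d"
    unfolding Ex_eq d_eq q by (rule refl)+

  \<comment> \<open>Continuity of the embedding of \<open>H\<close>\<close>
  define K where "K = sqrt (suminf a + (suminf w)\<^sup>2) + 1"
  have sums_nonneg: "suminf a \<ge> 0" "suminf w \<ge> 0"
    using a_nonneg w_nonneg a_summable w_summable by (auto intro: suminf_nonneg)
  \<comment> \<open>The two series at \<open>j h\<close> are at most
    \<open>suminf a * (norm h)\<^sup>2\<close> and \<open>suminf w * norm h\<close>, so
    \<open>K - 1\<close> already suffices as a bound. The added 1 yields \<open>K > 0\<close> from
    nonnegativity of the sums.\<close>
  have q_j: "S.q (j h) \<le> ennreal (K * norm h)" for h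
  proof -
    have le: "\<bar>p n (j h)\<bar> \<le> norm h" "\<bar>r n (j h)\<bar> \<le> norm h" for n
      using Cauchy_Schwarz_ineq2[of "e n" h] Cauchy_Schwarz_ineq2[of "ex n" h] p r unit by auto
    have "(\<Sum>n. ennreal (a n * (p n (j h))\<^sup>2)) \<le> ennreal (suminf a * (norm h)\<^sup>2)"
      using suminf_weighted_powers_le[OF le(1) a_nonneg a_summable, where k = 2] by simp
    moreover have "(\<Sum>n. ennreal (w n * \<bar>r n (j h)\<bar>)) \<le> ennreal (suminf w * norm h)"
      using suminf_weighted_powers_le[OF le(2) w_nonneg w_summable, where k = 1] by simp
    ultimately have "(q (j h))\<^sup>2 \<le> ennreal (suminf a * (norm h)\<^sup>2) + (ennreal (suminf w * norm h))\<^sup>2"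
      unfolding q_power2 by (intro add_mono power_mono) auto
    also have "\<dots> = ennreal ((suminf a + (suminf w)\<^sup>2) * (norm h)\<^sup>2)"
      using sums_nonneg
      by (simp add: ennreal_power power_mult_distrib distrib_right flip: ennreal_plus)
    also have "\<dots> \<le> (ennreal (K * norm h))\<^sup>2"
    proof -
      have "suminf a + (suminf w)\<^sup>2 \<le> K\<^sup>2"
        using sums_nonneg unfolding K_def by (intro sqrt_le_D) simp
      moreover have "K \<ge> 0"
        using sums_nonneg by (simp add: K_def)
      ultimately show ?thesis
        by (simp add: ennreal_power power_mult_distrib ennreal_leI mult_right_mono)
    qed
    finally show ?thesis
      unfolding q by (rule power2_le_imp_le_ennreal)
  qed
  have j_linear: "linear j"
    using embedding by (simp add: continuous_dense_embedding_def bounded_linear.linear)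
  have "K > 0"
    using sums_nonneg by (simp add: K_def add_nonneg_pos)
  note j_V = S.continuous_map_into_V[OF j_linear q_j \<open>K > 0\<close>]

  \<comment> \<open>Square integrability and null sets\<close>
  interpret prob_space "\<nu> t"
    using nu_prob[OF t_pos] by blast
  have sets [measurable_cong]: "sets (\<nu> t) = sets borel"
    using nu_prob[OF t_pos] by blast
  have space: "space (\<nu> t) = UNIV"
    using sets_eq_imp_space_eq[OF sets] by simp
  have pr_meas [measurable]: "p n \<in> borel_measurable borel" "r n \<in> borel_measurable borel" for n
    using cont by (auto intro: borel_measurable_continuous_onI)
  have q_meas [measurable]: "q \<in> borel_measurable borel"
    unfolding q by (rule S.q_measurable)

  have q_L2: "(\<integral>\<^sup>+z. (q z)\<^sup>2 \<partial>(\<nu> t)) < \<infinity>"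
  proof -
    obtain C0 where C0: "C0 > 0" "\<forall>\<xi>\<in>dual_in j. \<forall>s>0.
        (\<integral>\<^sup>+z. ennreal ((dual_pairing j \<xi> z)\<^sup>2) \<partial>(\<nu> s)) \<le> ennreal (C0 * (1 + s\<^sup>2) * (norm \<xi>)\<^sup>2)"
      using H_i by blast
    \<comment> \<open>All \<open>e n\<close> and \<open>ex n\<close> have norm 1, so at time
      \<open>t\<close> one constant bounds every second moment.\<close>
    define C where "C = C0 * (1 + t\<^sup>2)"
    have moment: "(\<integral>\<^sup>+z. ennreal ((p n z)\<^sup>2) \<partial>(\<nu> t)) \<le> ennreal C"
      "(\<integral>\<^sup>+z. ennreal ((r n z)\<^sup>2) \<partial>(\<nu> t)) \<le> ennreal C" for n
      using C0(2) e_basis(2)[of n] ex_basis(2)[of n] t_pos unit[of n]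
      by (fastforce simp: p_def r_def C_def)+
    have sum_moment: "(\<integral>\<^sup>+z. (\<Sum>n. ennreal (c n * (f n z)\<^sup>2)) \<partial>(\<nu> t)) < \<infinity>"
      if [measurable]: "\<And>n. f n \<in> borel_measurable borel"
        and c: "\<And>n. c n \<ge> 0" "summable c"
        and f: "\<And>n. (\<integral>\<^sup>+z. ennreal ((f n z)\<^sup>2) \<partial>(\<nu> t)) \<le> ennreal C"
      for c :: "nat \<Rightarrow> real" and f :: "nat \<Rightarrow> 'e \<Rightarrow> real"
    proof -
      have "(\<integral>\<^sup>+z. (\<Sum>n. ennreal (c n * (f n z)\<^sup>2)) \<partial>(\<nu> t))
          = (\<Sum>n. ennreal (c n) * (\<integral>\<^sup>+z. ennreal ((f n z)\<^sup>2) \<partial>(\<nu> t)))"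
        using c by (simp add: nn_integral_suminf ennreal_mult nn_integral_cmult)
      also have "\<dots> \<le> (\<Sum>n. ennreal (c n) * ennreal C)"
        by (intro suminf_le mult_left_mono f) auto
      also have "\<dots> = ennreal (suminf c) * ennreal C"
        using c by (simp add: suminf_ennreal2)
      also have "\<dots> < \<infinity>"
        by (simp add: ennreal_mult_less_top)
      finally show ?thesis .
    qed
    have "(\<integral>\<^sup>+z. (q z)\<^sup>2 \<partial>(\<nu> t)) \<le> (\<integral>\<^sup>+z. (\<Sum>n. ennreal (a n * (p n z)\<^sup>2)) +
        ennreal (suminf w) * (\<Sum>n. ennreal (w n * (r n z)\<^sup>2)) \<partial>(\<nu> t))"
      unfolding q_power2 suminf_ennreal2[OF w_nonneg w_summable, symmetric]
      by (intro nn_integral_mono add_left_mono weighted_Cauchy_Schwarz_suminf w_nonneg)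
    also have "\<dots> = (\<integral>\<^sup>+z. (\<Sum>n. ennreal (a n * (p n z)\<^sup>2)) \<partial>(\<nu> t)) +
        ennreal (suminf w) * (\<integral>\<^sup>+z. (\<Sum>n. ennreal (w n * (r n z)\<^sup>2)) \<partial>(\<nu> t))"
      by (simp add: nn_integral_add nn_integral_cmult)
    also have "\<dots> < \<infinity>"
      using sum_moment[OF pr_meas(1) a_nonneg a_summable moment(1)]
        sum_moment[OF pr_meas(2) w_nonneg w_summable moment(2)]
      by (simp add: ennreal_mult_less_top)
    finally show ?thesis .
  qed

  have Ex_AE: "AE z in \<nu> t. z \<in> Ex"
  proof -
    have "AE z in \<nu> t. (q z)\<^sup>2 \<noteq> \<infinity>"
      using q_L2 by (intro nn_integral_PInf_AE) auto
    then show ?thesis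
      by eventually_elim (auto simp: Ex_eq fin_dom_def power_eq_top_ennreal less_top)
  qed
  have Ex_prob: "emeasure (\<nu> t) Ex = 1"
    using q_meas Ex_AE by (intro emeasure_eq_1_AE) (auto simp: sets Ex_eq fin_dom_def)

  text \<open>Every term of the second series is at least 1 at \<open>x\<close>, so the series diverges.\<close>
  have "x \<notin> Ex"
  proof
    assume "x \<in> Ex"
    then have "(q x)\<^sup>2 < top"
      by (simp add: Ex_eq fin_dom_def power_less_top_ennreal)
    then have "(\<Sum>n. ennreal (w n * \<bar>r n x\<bar>)) < top"
      by (simp add: q_power2 power_less_top_ennreal)
    then have "summable (\<lambda>n. w n * \<bar>r n x\<bar>)"
      using w_nonneg by (intro summable_suminf_not_top) auto
    then have "(\<lambda>n. w n * \<bar>r n x\<bar>) \<longlonglongrightarrow> 0"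
      by (rule summable_LIMSEQ_zero)
    moreover have "1 \<le> w n * \<bar>r n x\<bar>" for n
    proof -
      have "1 = w n * 2 powr ((real n + 1) / 2)"
        by (simp add: w_def flip: powr_add add_divide_distrib)
      also have "\<dots> \<le> w n * \<bar>r n x\<bar>"
        using ex_large[of n] w_nonneg by (intro mult_left_mono) (auto simp: r_def)
      finally show ?thesis .
    qed
    ultimately show False
      using LIMSEQ_le_const[of _ 0 1] by fastforce
  qed
  have translate: "range (\<lambda>h. j h + x) \<in> null_sets (\<nu> t)"
  proof (rule null_setsI)
    \<comment> \<open>Measurability is transported from \<open>range j\<close>, measurable by
      \<open>H_ii\<close>, through a continuous translation. Nullity comes afterwards from
      disjointness with \<open>Ex\<close>.\<close>
    have "range (\<lambda>h. j h + x) = (\<lambda>z. z - x) -` range j \<inter> space borel"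
      by (auto simp: image_iff algebra_simps)
    also have "\<dots> \<in> sets borel"
      using H_ii[OF t_pos]
      by (intro measurable_sets[of _ borel borel] borel_measurable_continuous_onI continuous_intros)
        (auto simp: sets)
    finally show meas: "range (\<lambda>h. j h + x) \<in> sets (\<nu> t)"
      by (simp add: sets)
    \<comment> \<open>Otherwise subtracting \<open>j h\<close>, which lies in the subspace, would
      put \<open>x\<close> in \<open>Ex\<close>.\<close>
    have "j h + x \<notin> Ex" for h
      using \<open>x \<notin> Ex\<close> j_V(1) subspace_diff[OF S.subspace_V, of "j h + x" "j h"]
      unfolding Ex by auto
    with Ex_AE have "AE z in \<nu> t. z \<notin> range (\<lambda>h. j h + x)"
      by (elim eventually_mono) blast
    then show "emeasure (\<nu> t) (range (\<lambda>h. j h + x)) = 0"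
      using meas by (subst (asm) AE_iff_measurable[OF meas]) (auto simp: space)
  qed

  \<comment> \<open>Compactness and the norm inequality\<close>
  have compact: "compact (closure A)" if A: "S.mbounded A" for A
  proof -
    obtain R where "R \<ge> 0" "\<And>z. z \<in> A \<Longrightarrow> S.q z \<le> ennreal R"
      using S.mbounded_imp_q_bounded[OF A] by blast
    then have "(\<Sum>n<M. \<alpha> n * (b n \<bullet> z)\<^sup>2) \<le> R\<^sup>2" if "z \<in> A" for z M
      using that by (intro ellipsoid) (simp add: S.q_le_iff)
    then show ?thesis
      by (rule compact_closure_weighted_ellipsoid[OF b alpha_mono alpha_pos alpha_lim])
  qed
  have norm_le: "ennreal (norm z) \<le> q z" if "1 \<le> \<alpha> 0" for z
  proof -
    have "norm z \<le> sqrt (\<alpha> 0) * norm z"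
      using that mult_right_mono[of 1 "sqrt (\<alpha> 0)" "norm z"] by simp
    then show ?thesis
      using S.norm_le_q[of z] by (auto simp: q intro: order_trans ennreal_leI)
  qed
  have "q \<in> borel_measurable (\<nu> t)"
    by measurable
  then show ?thesis
    using q_L2 Ex_prob translate S.norm_on_subspace_V S.Metric_space_axioms j_V S.norm_le_q norm_le
      S.mcomplete_V S.continuous_inclusion compact
    unfolding Ex d q by blast
qed

end
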